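(* Let $\Gamma$ be a graph with a vertex partition $\{C_1,\dots,C_6,D\}$ such that: (i) $|C_1|=\cdots=|C_6|=2$; write $C_i=\{v_{i1},v_{i2}\}$. (ii) For every vertex $v\in D$, the numbers of neighbours of $v$ in $C_1,\dots,C_6$ are all congruent modulo $2$. (iii) The adjacency matrix $B$ of the induced subgraph on $C_1\cup\dots\cup C_6$, with vertices ordered $v_{11},v_{12},v_{21},v_{22},\dots,v_{61},v_{62}$, is one of the 18 matrices $B_1,\dots,B_{18}$ listed in the context, where any $2\times 2$ block $B_{ij}$ with $i\neq j$, together with its transpose $B_{ji}$, may be replaced by its complement $J-B_{ij}$ (resp. $J-B_{ji}$). Let $\pi$ be the permutation of $C_1\cup\dots\cup C_6$ with $\pi(v_{ia})=v_{i-1,a}$ (indices $i$ modulo $6$). Construct $\Gamma'$ from $\Gamma$ on the same vertex set as follows, leaving all other adjacencies unchanged: for every $v\in D$ that has exactly one neighbour $w$ in each $C_i$, replace each such edge $\{v,w\}$ by $\{v,\pi(w)\}$; and replace the induced subgraph on $C_1\cup\dots\cup C_6$ by the one with adjacency matrix $R_{12}^TBR_{12}$ (same vertex ordering). Then $\Gamma'$ is $\mathbb{R}$-cospectral with $\Gamma$.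
   Context: Graphs are finite, simple and loopless. Two graphs with adjacency matrices $A$ and $A'$ are $\mathbb{R}$-cospectral if $A+rJ$ and $A'+rJ$ have the same spectrum for every $r\in\mathbb{R}$, where $J$ is the all-ones matrix. All blocks are $2\times 2$: $I$ identity, $J$ all-ones, $O$ zero, $Y=2I-J$, $N=\begin{bmatrix}0&0\\1&1\end{bmatrix}$, and write $n:=N^T$. $R_{12}=\frac12\,\mathrm{circulant}(J,O,O,O,O,Y)$ is the $12\times12$ matrix with $\frac12J$ in block positions $(i,i)$, $\frac12Y$ in block positions $(i,i-1)$ (indices modulo 6), and $O$ elsewhere. Each $B_k$ is the symmetric $12\times12$ matrix consisting of $6\times 6$ blocks with $B_{ii}=O$, $B_{ji}=B_{ij}^T$ and blocks above the diagonal, listed as $(B_{12},B_{13},B_{14},B_{15},B_{16}\mid B_{23},B_{24},B_{25},B_{26}\mid B_{34},B_{35},B_{36}\mid B_{45},B_{46}\mid B_{56})$: $B_1$: $(O,I,O,N,n\mid O,I,O,N\mid N,n,O\mid N,O\mid I)$ $B_2$: $(O,I,I,n,I\mid O,I,N,N\mid N,N,n\mid I,O\mid I)$ $B_3$: $(O,I,I,N,n\mid O,I,I,N\mid N,n,I\mid N,O\mid I)$ $B_4$: $(O,I,n,N,O\mid O,N,N,n\mid N,O,O\mid I,O\mid I)$ $B_5$: $(O,I,n,N,O\mid O,N,N,n\mid N,n,O\mid N,n\mid N)$ $B_6$: $(O,N,n,I,n\mid O,N,n,N\mid O,N,N\mid N,n\mid O)$ $B_7$: $(O,N,n,N,n\mid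 O,N,n,N\mid O,N,N\mid N,n\mid N)$ $B_8$: $(O,I,I,I,n\mid N,n,I,N\mid O,I,I\mid N,n\mid O)$ $B_9$: $(O,I,N,n,n\mid N,n,n,N\mid O,N,O\mid N,n\mid O)$ $B_{10}$: $(O,I,O,N,n\mid N,n,O,N\mid N,O,O\mid I,O\mid I)$ $B_{11}$: $(O,I,I,N,n\mid N,n,I,N\mid N,O,I\mid I,O\mid I)$ $B_{12}$: $(O,N,N,n,n\mid N,n,n,N\mid O,N,N\mid N,n\mid O)$ $B_{13}$: $(I,O,I,N,n\mid I,N,n,n\mid I,n,N\mid N,n\mid N)$ $B_{14}$: $(I,N,n,N,n\mid I,N,n,n\mid I,n,N\mid N,O\mid I)$ $B_{15}$: $(I,N,n,N,n\mid I,N,n,n\mid I,n,N\mid N,n\mid N)$ $B_{16}$: $(I,n,O,N,n\mid N,O,O,O\mid I,n,O\mid N,O\mid I)$ $B_{17}$: $(I,n,N,N,n\mid N,O,I,n\mid I,n,N\mid N,N\mid I)$ $B_{18}$: $(I,n,N,N,n\mid N,N,n,n\mid I,n,N\mid N,N\mid I)$ *)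

theory Defs
  imports
    "Graph_Theory.Pair_Digraph"
    "Jordan_Normal_Form.Char_Poly"
    "HOL-Library.Disjoint_Sets"
    "HOL-Number_Theory.Cong"
begin

text \<open>
  A finite simple loopless graph is a \<^term>\<open>pair_graph\<close>: an edge \<open>{x, y}\<close> is represented by
  the two arcs \<open>(x, y)\<close> and \<open>(y, x)\<close>.
\<close>

definition neighbours_in :: "'a pair_pre_digraph \<Rightarrow> 'a \<Rightarrow> 'a set \<Rightarrow> 'a set" where
  "neighbours_in G x S = {u \<in> S. (x, u) \<in> parcs G}"

text \<open>
  The list \<open>vs\<close> fixes the vertex ordering. If \<open>vs\<close> does not enumerate all the vertices of
  \<open>G\<close>, this is the adjacency matrix of the subgraph induced by \<open>set vs\<close>.
\<close>

definition adjacency_mat :: "'a pair_pre_digraph \<Rightarrow> 'a list \<Rightarrow> real mat" where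
  "adjacency_mat G vs = mat (length vs) (length vs)
     (\<lambda>(i, j). if (vs ! i, vs ! j) \<in> parcs G then 1 else 0)"

definition ones_mat :: "nat \<Rightarrow> real mat" where
  "ones_mat n = mat n n (\<lambda>_. 1)"

text \<open>
  Eigenvalues over \<open>\<complex>\<close>, counted with algebraic multiplicity, so that no eigenvalue
  is lost for any real square matrix.
\<close>

definition spectrum_mset :: "real mat \<Rightarrow> complex multiset" where
  "spectrum_mset A = proots (char_poly (map_mat complex_of_real A))"

text \<open>
  The spectrum does not depend on the chosen orderings of the vertices; the definition asks for
  equality for all of them.
\<close>

definition R_cospectral :: "'a pair_pre_digraph \<Rightarrow> 'b pair_pre_digraph \<Rightarrow> bool" where
  "R_cospectral G H \<longleftrightarrow>
     (\<forall>vs ws. distinct vs \<and> set vs = pverts G \<and> distinct ws \<and> set ws = pverts H \<longrightarrow>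
       (\<forall>r::real. spectrum_mset (adjacency_mat G vs + r \<cdot>\<^sub>m ones_mat (length vs)) =
                  spectrum_mset (adjacency_mat H ws + r \<cdot>\<^sub>m ones_mat (length ws))))"

definition I2 :: "real mat" where "I2 = 1\<^sub>m 2"
definition J2 :: "real mat" where "J2 = ones_mat 2"
definition O2 :: "real mat" where "O2 = 0\<^sub>m 2 2"
definition Y2 :: "real mat" where "Y2 = 2 \<cdot>\<^sub>m I2 - J2"
definition N2 :: "real mat" where "N2 = mat_of_rows_list 2 [[0, 0], [1, 1]]"
definition n2 :: "real mat" where "n2 = transpose_mat N2"

text \<open>Block indices are \<open>0, \<dots>, 5\<close> instead of \<open>1, \<dots>, 6\<close>.\<close>

definition block_mat :: "(nat \<Rightarrow> nat \<Rightarrow> real mat) \<Rightarrow> real mat" where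
  "block_mat f = mat 12 12 (\<lambda>(r, c). f (r div 2) (c div 2) $$ (r mod 2, c mod 2))"

text \<open>Each block row is the previous one shifted cyclically to the right by one block.\<close>

definition block_circulant :: "real mat list \<Rightarrow> real mat" where
  "block_circulant Ls = block_mat (\<lambda>i j. Ls ! ((j + 6 - i) mod 6))"

definition R12 :: "real mat" where
  "R12 = (1 / 2) \<cdot>\<^sub>m block_circulant [J2, O2, O2, O2, O2, Y2]"

text \<open>
  The entry \<open>switching_blocks ! k ! i ! (j - i - 1)\<close> is the block in position \<open>(i, j)\<close>,
  \<open>i < j\<close>, of the matrix \<open>B\<close> with index \<open>k + 1\<close>.
\<close>

definition switching_blocks :: "real mat list list list" where
  "switching_blocks =
   [[[O2, I2, O2, N2, n2], [O2, I2, O2, N2], [N2, n2, O2], [N2, O2], [I2]],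
    [[O2, I2, I2, n2, I2], [O2, I2, N2, N2], [N2, N2, n2], [I2, O2], [I2]],
    [[O2, I2, I2, N2, n2], [O2, I2, I2, N2], [N2, n2, I2], [N2, O2], [I2]],
    [[O2, I2, n2, N2, O2], [O2, N2, N2, n2], [N2, O2, O2], [I2, O2], [I2]],
    [[O2, I2, n2, N2, O2], [O2, N2, N2, n2], [N2, n2, O2], [N2, n2], [N2]],
    [[O2, N2, n2, I2, n2], [O2, N2, n2, N2], [O2, N2, N2], [N2, n2], [O2]],
    [[O2, N2, n2, N2, n2], [O2, N2, n2, N2], [O2, N2, N2], [N2, n2], [N2]],
    [[O2, I2, I2, I2, n2], [N2, n2, I2, N2], [O2, I2, I2], [N2, n2], [O2]],
    [[O2, I2, N2, n2, n2], [N2, n2, n2, N2], [O2, N2, O2], [N2, n2], [O2]],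
    [[O2, I2, O2, N2, n2], [N2, n2, O2, N2], [N2, O2, O2], [I2, O2], [I2]],
    [[O2, I2, I2, N2, n2], [N2, n2, I2, N2], [N2, O2, I2], [I2, O2], [I2]],
    [[O2, N2, N2, n2, n2], [N2, n2, n2, N2], [O2, N2, N2], [N2, n2], [O2]],
    [[I2, O2, I2, N2, n2], [I2, N2, n2, n2], [I2, n2, N2], [N2, n2], [N2]],
    [[I2, N2, n2, N2, n2], [I2, N2, n2, n2], [I2, n2, N2], [N2, O2], [I2]],
    [[I2, N2, n2, N2, n2], [I2, N2, n2, n2], [I2, n2, N2], [N2, n2], [N2]],
    [[I2, n2, O2, N2, n2], [N2, O2, O2, O2], [I2, n2, O2], [N2, O2], [I2]],
    [[I2, n2, N2, N2, n2], [N2, O2, I2, n2], [I2, n2, N2], [N2, N2], [I2]],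
    [[I2, n2, N2, N2, n2], [N2, N2, n2, n2], [I2, n2, N2], [N2, N2], [I2]]]"

definition upper_block :: "nat \<Rightarrow> nat \<Rightarrow> nat \<Rightarrow> real mat" where
  "upper_block k i j = switching_blocks ! k ! i ! (j - i - 1)"

definition sym_block_mat :: "(nat \<Rightarrow> nat \<Rightarrow> real mat) \<Rightarrow> real mat" where
  "sym_block_mat U = block_mat
     (\<lambda>i j. if i < j then U i j else if j < i then transpose_mat (U j i) else O2)"

text \<open>The set \<open>S\<close> consists of the positions above the diagonal whose blocks are complemented.\<close>

definition switching_matrices :: "real mat set" where
  "switching_matrices =
     {sym_block_mat (\<lambda>i j. if (i, j) \<in> S then J2 - upper_block k i j else upper_block k i j)
       | k S. k < 18}"

text \<open>
  The vertices \<open>v 0 0, v 0 1, v 1 0, v 1 1, \<dots>, v 5 0, v 5 1\<close>: both indices of \<open>v\<close> are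
  shifted to start from \<open>0\<close>.
\<close>

definition vertex_list :: "(nat \<Rightarrow> nat \<Rightarrow> 'a) \<Rightarrow> 'a list" where
  "vertex_list v = concat (map (\<lambda>i. [v i 0, v i 1]) [0..<6])"

definition switched_mat :: "'a pair_pre_digraph \<Rightarrow> (nat \<Rightarrow> nat \<Rightarrow> 'a) \<Rightarrow> real mat" where
  "switched_mat G v = transpose_mat R12 * adjacency_mat G (vertex_list v) * R12"

definition switch_vertices ::
    "'a pair_pre_digraph \<Rightarrow> (nat \<Rightarrow> 'a set) \<Rightarrow> 'a set \<Rightarrow> 'a set" where
  "switch_vertices G C D = {x \<in> D. \<forall>i<6. card (neighbours_in G x (C i)) = 1}"

definition switched_graph ::
    "'a pair_pre_digraph \<Rightarrow> (nat \<Rightarrow> 'a set) \<Rightarrow> 'a set \<Rightarrow> (nat \<Rightarrow> nat \<Rightarrow> 'a) \<Rightarrow> ('a \<Rightarrow> 'a)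
      \<Rightarrow> 'a pair_pre_digraph" where
  "switched_graph G C D v p =
     (let U = (\<Union>i<6. C i); X = switch_vertices G C D; vs = vertex_list v in
      \<lparr>pverts = pverts G,
       parcs = (parcs G - (X \<times> U \<union> U \<times> X \<union> U \<times> U))
         \<union> {(x, p w) | x w. x \<in> X \<and> w \<in> U \<and> (x, w) \<in> parcs G}
         \<union> {(p w, x) | x w. x \<in> X \<and> w \<in> U \<and> (w, x) \<in> parcs G}
         \<union> {(vs ! r, vs ! c) | r c. r < 12 \<and> c < 12 \<and> switched_mat G v $$ (r, c) = 1}\<rparr>)"

end

theory Submission
  imports Defs
begin

text \<open>
  Let \<open>Q\<close> be the matrix that is \<^const>\<open>R12\<close> on the twelve switched vertices and the identity
  on \<open>D\<close>. It is orthogonal with all column sums \<open>1\<close>, so \<open>Q\<^sup>T (A + r J) Q = Q\<^sup>T A Q + r J\<close>, and it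
  remains to see that \<open>Q\<^sup>T A Q\<close> is the adjacency matrix of the switched graph. For a vertex of
  \<open>D\<close> this is a computation with the parity condition. On the twelve vertices, each entry of the
  conjugate of \<open>B\<close> is a signed sum of row, column and diagonal differences of four neighbouring
  blocks of \<open>B\<close>.
\<close>

section \<open>Matrices indexed by vertices\<close>

text \<open>Two lists, because rows and columns may follow different orderings of the same vertices:
  one matrix can then conjugate and reorder at once.\<close>

definition kernel_mat :: "('a \<Rightarrow> 'b \<Rightarrow> real) \<Rightarrow> 'a list \<Rightarrow> 'b list \<Rightarrow> real mat" where
  "kernel_mat f us vs = mat (length us) (length vs) (\<lambda>(i, j). f (us ! i) (vs ! j))"

lemma kernel_mat_carrier [simp]: "kernel_mat f us vs \<in> carrier_mat (length us) (length vs)"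
  by (simp add: kernel_mat_def)

lemma kernel_mat_cong:
  assumes "\<And>x y. x \<in> set us \<Longrightarrow> y \<in> set vs \<Longrightarrow> f x y = g x y"
  shows "kernel_mat f us vs = kernel_mat g us vs"
  using assms by (intro eq_matI) (auto simp: kernel_mat_def)

lemma transpose_kernel_mat: "transpose_mat (kernel_mat f us vs) = kernel_mat (\<lambda>x y. f y x) vs us"
  by (intro eq_matI) (auto simp: kernel_mat_def)

lemma sum_nth_distinct: "distinct vs \<Longrightarrow> (\<Sum>i<length vs. h (vs ! i)) = sum h (set vs)"
  by (intro sum.reindex_bij_betw bij_betw_nth) auto

lemma kernel_mat_mult:
  assumes "distinct vs"
  shows "kernel_mat f us vs * kernel_mat g vs ws =
    kernel_mat (\<lambda>x z. \<Sum>y\<in>set vs. f x y * g y z) us ws"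
  by (intro eq_matI)
    (auto simp: kernel_mat_def scalar_prod_def sum_nth_distinct[OF assms, symmetric] atLeast0LessThan)

lemma kernel_mat_one:
  assumes "distinct vs"
  shows "kernel_mat (\<lambda>x y. if x = y then 1 else 0) vs vs = 1\<^sub>m (length vs)"
  using assms by (intro eq_matI) (auto simp: kernel_mat_def nth_eq_iff_index_eq)

section \<open>Spectra under orthogonal conjugation\<close>

lemma spectrum_mset_similar:
  assumes "similar_mat A B"
  shows "spectrum_mset A = spectrum_mset B"
proof -
  from similar_matD[OF assms] obtain n where "{A, B} \<subseteq> carrier_mat n n" by blast
  then have "A \<in> carrier_mat n n" "B \<in> carrier_mat n n" by auto
  then show ?thesis
    \<comment> \<open>Similarity holds over the reals; forming \<open>char_poly\<close> commutes
      with the embedding into the complex numbers.\<close>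
    using char_poly_similar[OF assms] by (simp add: spectrum_mset_def of_real_hom.char_poly_hom)
qed

text \<open>Taking the rows of \<open>Q\<close> in the order \<open>vs\<close> and its columns in
  the order \<open>ws\<close> makes the change of ordering part of the conjugation. The hypothesis
  \<open>orth\<close> gives only a left inverse, which for a square matrix is also a right
  inverse.\<close>

lemma spectrum_mset_kernel_mat_eq:
  assumes vs: "distinct vs" "set vs = V" and ws: "distinct ws" "set ws = V"
    and orth: "\<And>x z. x \<in> V \<Longrightarrow> z \<in> V \<Longrightarrow> (\<Sum>y\<in>V. Q y x * Q y z) = (if x = z then 1 else 0)"
    and conj: "\<And>x z. x \<in> V \<Longrightarrow> z \<in> V \<Longrightarrow> g x z = (\<Sum>y\<in>V. Q y x * (\<Sum>w\<in>V. f y w * Q w z))"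
  shows "spectrum_mset (kernel_mat f vs vs) = spectrum_mset (kernel_mat g ws ws)"
proof -
  let ?n = "length vs" and ?P = "kernel_mat Q vs ws" and ?F = "kernel_mat f vs vs"
    and ?G = "kernel_mat g ws ws"
  have n: "length ws = ?n" using vs ws by (metis distinct_card)
  have carrier: "?P \<in> carrier_mat ?n ?n" "?F \<in> carrier_mat ?n ?n" "?G \<in> carrier_mat ?n ?n"
    using kernel_mat_carrier[of _ vs ws] kernel_mat_carrier[of _ vs vs] kernel_mat_carrier[of _ ws ws]
    unfolding n by blast+
  have "transpose_mat ?P * ?P = kernel_mat (\<lambda>x z. if x = z then 1 else 0) ws ws"
    unfolding transpose_kernel_mat kernel_mat_mult[OF vs(1)] vs(2)
    using orth ws(2) by (intro kernel_mat_cong) auto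
  then have left: "transpose_mat ?P * ?P = 1\<^sub>m ?n" by (simp add: kernel_mat_one ws(1) n)
  then have right: "?P * transpose_mat ?P = 1\<^sub>m ?n"
    using mat_mult_left_right_inverse[of "transpose_mat ?P" ?n ?P] carrier(1) by simp
  have "transpose_mat ?P * (?F * ?P) = ?G"
    unfolding transpose_kernel_mat kernel_mat_mult[OF vs(1)] vs(2)
    using conj ws(2) by (intro kernel_mat_cong) auto
  moreover have "transpose_mat ?P * ?F * ?P = transpose_mat ?P * (?F * ?P)"
    using carrier by (intro assoc_mult_mat) auto
  ultimately have "?G = transpose_mat ?P * ?F * ?P" by simp
  then have "similar_mat ?G ?F"
    by (intro similar_matI[OF _ left right]) (use carrier in \<open>auto simp del: kernel_mat_carrier\<close>)
  then show ?thesis using spectrum_mset_similar by metis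
qed

section \<open>Conjugation of block matrices by \<^const>\<open>R12\<close>\<close>

lemmas block_defs = O2_def I2_def J2_def Y2_def n2_def N2_def ones_mat_def mat_of_rows_list_def

text \<open>\<open>Y2\<close> has rank one: its entry at \<open>(a, b)\<close> is
  \<open>sgn2 a * sgn2 b\<close>, which separates row signs from column signs.\<close>

definition sgn2 :: "nat \<Rightarrow> real" where "sgn2 a = (if a = 0 then 1 else - 1)"

lemma less_6_cases: "(i::nat) < 6 \<longleftrightarrow> i = 0 \<or> i = 1 \<or> i = 2 \<or> i = 3 \<or> i = 4 \<or> i = 5"
  by auto

lemma sgn2_square [simp]: "sgn2 a * sgn2 a = 1"
  by (simp add: sgn2_def)

lemma R12_carrier: "R12 \<in> carrier_mat 12 12"
  by (simp add: R12_def block_circulant_def block_mat_def)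

text \<open>\<open>Y2\<close> is the last block of the circulant list, so in column block
  \<open>i\<close> it stands where \<open>(i + 6 - j) mod 6 = 5\<close>, that is, in the row block
  after \<open>i\<close>.\<close>

lemma R12_entry:
  assumes "i < 6" "j < 6" "a < 2" "b < 2"
  shows "R12 $$ (2 * j + b, 2 * i + a) =
    (if j = i then 1 / 2 else if j = (i + 1) mod 6 then sgn2 a * sgn2 b / 2 else 0)"
proof -
  have ab: "(2 * j + b) div 2 = j" "(2 * j + b) mod 2 = b" "(2 * i + a) div 2 = i" "(2 * i + a) mod 2 = a"
    "2 * j + b < 12" "2 * i + a < 12"
    using assms by auto
  have "R12 $$ (2 * j + b, 2 * i + a) =
      ([J2, O2, O2, O2, O2, Y2] ! ((i + 6 - j) mod 6)) $$ (b, a) / 2"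
    using ab by (simp add: R12_def block_circulant_def block_mat_def)
  also have "\<dots> = (if j = i then 1 / 2 else if j = (i + 1) mod 6 then sgn2 a * sgn2 b / 2 else 0)"
    using assms(1,2) unfolding less_6_cases
    by (elim disjE; insert assms(3,4); auto simp: less_2_cases_iff sgn2_def block_defs)
  finally show ?thesis .
qed

text \<open>A column meets just two pairs of rows: \<open>J2\<close> averages \<open>f\<close> over
  pair \<open>i\<close>, and \<open>Y2\<close> takes a signed half difference over the next pair.
  Later sums against a column of \<open>R12\<close> are evaluated by this formula.\<close>

lemma R12_column_sum:
  assumes "i < 6" "a < 2"
  shows "(\<Sum>s<12. R12 $$ (s, 2 * i + a) * f s) =
    (f (2 * i) + f (2 * i + 1)) / 2
      + sgn2 a * (f (2 * ((i + 1) mod 6)) - f (2 * ((i + 1) mod 6) + 1)) / 2"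
proof -
  define i' where "i' = (i + 1) mod 6"
  have i': "i' < 6" "i' \<noteq> i" using assms(1) by (auto simp: i'_def less_6_cases)
  have "(\<Sum>s<12. h s) = (\<Sum>j<6. h (2 * j + 0) + h (2 * j + 1))" for h :: "nat \<Rightarrow> real"
    by (simp add: eval_nat_numeral lessThan_Suc)
  then have "(\<Sum>s<12. R12 $$ (s, 2 * i + a) * f s) =
      (\<Sum>j<6. R12 $$ (2 * j + 0, 2 * i + a) * f (2 * j + 0) + R12 $$ (2 * j + 1, 2 * i + a) * f (2 * j + 1))" .
  also have "\<dots> = (\<Sum>j<6. (if j = i then (f (2 * i) + f (2 * i + 1)) / 2 else 0) +
       (if j = i' then sgn2 a * (f (2 * i') - f (2 * i' + 1)) / 2 else 0))"
  proof (intro sum.cong refl)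
    fix j :: nat assume "j \<in> {..<6}"
    then have "j < 6" by simp
    from R12_entry[OF assms(1) this assms(2), of 0] R12_entry[OF assms(1) this assms(2), of 1]
    show "R12 $$ (2 * j + 0, 2 * i + a) * f (2 * j + 0) + R12 $$ (2 * j + 1, 2 * i + a) * f (2 * j + 1) =
        (if j = i then (f (2 * i) + f (2 * i + 1)) / 2 else 0) +
        (if j = i' then sgn2 a * (f (2 * i') - f (2 * i' + 1)) / 2 else 0)"
      using i'(2) unfolding i'_def[symmetric] by (simp add: sgn2_def field_simps)
  qed
  finally show ?thesis using assms(1) i'(1) unfolding i'_def[symmetric] by (simp add: sum.distrib)
qed

lemma sum_R12_column: "c < 12 \<Longrightarrow> (\<Sum>s<12. R12 $$ (s, c)) = 1"
  using R12_column_sum[of "c div 2" "c mod 2" "\<lambda>_. 1"] by simp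

text \<open>Apply the column formula to column \<open>c\<close>. Averaging over a pair kills the
  \<open>Y2\<close> part and differencing kills the \<open>J2\<close> part, so only
  \<open>i = j\<close> contributes, with value \<open>(1 + sgn2 a * sgn2 b) / 2\<close>.\<close>

lemma R12_orthogonal:
  assumes "r < 12" "c < 12"
  shows "(\<Sum>s<12. R12 $$ (s, r) * R12 $$ (s, c)) = (if r = c then 1 else 0)"
proof -
  define i a j b where ij: "i = r div 2" "a = r mod 2" "j = c div 2" "b = c mod 2"
  define i' j' where ij': "i' = (i + 1) mod 6" "j' = (j + 1) mod 6"
  have rc: "r = 2 * i + a" "c = 2 * j + b" and lt: "i < 6" "a < 2" "j < 6" "b < 2"
    using assms by (auto simp: ij)
  have "i' < 6" "i' \<noteq> i" "i' = j' \<longleftrightarrow> i = j"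
    using lt(1,3) unfolding ij' less_6_cases by (elim disjE; simp)+
  moreover have "R12 $$ (2 * k, 2 * j + b) = (if k = j then 1 / 2 else if k = j' then sgn2 b / 2 else 0)"
    "R12 $$ (2 * k + 1, 2 * j + b) = (if k = j then 1 / 2 else if k = j' then - sgn2 b / 2 else 0)"
    if "k < 6" for k
    using R12_entry[OF lt(3) that lt(4), of 0] R12_entry[OF lt(3) that lt(4), of 1]
    by (simp_all add: sgn2_def ij')
  moreover have "r = c \<longleftrightarrow> i = j \<and> a = b" using lt unfolding rc by presburger
  moreover have "sgn2 a * sgn2 b = (if a = b then 1 else - 1)"
    using lt by (auto simp: sgn2_def less_2_cases_iff)
  ultimately show ?thesis
    unfolding rc(1) R12_column_sum[OF lt(1,2)] ij'(1)[symmetric] rc(2) using lt by simp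
qed

text \<open>This and the next three definitions are, up to scaling, the Walsh-Hadamard coefficients
  of a 2 x 2 block, belonging to the signs \<open>1\<close>, \<open>sgn2 b\<close>,
  \<open>sgn2 a\<close> and \<open>sgn2 a * sgn2 b\<close> for row \<open>a\<close> and column
  \<open>b\<close>.\<close>

definition block_sum :: "real mat \<Rightarrow> real" where
  "block_sum M = M $$ (0, 0) + M $$ (0, 1) + M $$ (1, 0) + M $$ (1, 1)"

definition col_diff :: "real mat \<Rightarrow> real" where
  "col_diff M = M $$ (0, 0) - M $$ (0, 1) + M $$ (1, 0) - M $$ (1, 1)"

definition row_diff :: "real mat \<Rightarrow> real" where
  "row_diff M = M $$ (0, 0) + M $$ (0, 1) - M $$ (1, 0) - M $$ (1, 1)"

definition diag_diff :: "real mat \<Rightarrow> real" where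
  "diag_diff M = M $$ (0, 0) - M $$ (0, 1) - M $$ (1, 0) + M $$ (1, 1)"

lemmas block_stat_defs = block_sum_def col_diff_def row_diff_def diag_diff_def

lemma conjugate_entry:
  assumes "B \<in> carrier_mat 12 12" "r < 12" "c < 12"
  shows "(transpose_mat R12 * B * R12) $$ (r, c) =
    (\<Sum>s<12. R12 $$ (s, r) * (\<Sum>t<12. R12 $$ (t, c) * B $$ (s, t)))"
proof -
  have "transpose_mat R12 * B * R12 = transpose_mat R12 * (B * R12)"
    using assms(1) R12_carrier by (simp add: assoc_mult_mat[of _ 12 12 _ 12 _ 12])
  moreover have "(B * R12) $$ (s, c) = (\<Sum>t<12. R12 $$ (t, c) * B $$ (s, t))" if "s < 12" for s
    using assms R12_carrier that by (simp add: scalar_prod_def atLeast0LessThan mult.commute)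
  moreover have "(transpose_mat R12 * M) $$ (r, c) = (\<Sum>s<12. R12 $$ (s, r) * M $$ (s, c))"
    if "M \<in> carrier_mat 12 12" for M
    using assms R12_carrier that by (simp add: scalar_prod_def atLeast0LessThan)
  ultimately show ?thesis using mult_carrier_mat[OF assms(1) R12_carrier] by simp
qed

text \<open>The column formula is applied on both sides of the matrix. \<open>J2\<close> against
  \<open>J2\<close> sees block \<open>(i, j)\<close>, the mixed products see \<open>(i, j')\<close>
  and \<open>(i', j)\<close>, and \<open>Y2\<close> against \<open>Y2\<close> sees
  \<open>(i', j')\<close>. The factor 4 clears the halves.\<close>

lemma conjugate_block_mat_entry:
  assumes "i < 6" "j < 6" "a < 2" "b < 2"
  defines "i' \<equiv> (i + 1) mod 6" and "j' \<equiv> (j + 1) mod 6"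
  shows "4 * (transpose_mat R12 * block_mat F * R12) $$ (2 * i + a, 2 * j + b) =
    block_sum (F i j) + sgn2 b * col_diff (F i j') + sgn2 a * row_diff (F i' j)
      + sgn2 a * sgn2 b * diag_diff (F i' j')"
proof -
  have B: "block_mat F \<in> carrier_mat 12 12" by (simp add: block_mat_def)
  have lt: "i' < 6" "j' < 6" by (simp_all add: i'_def j'_def)
  have entry: "block_mat F $$ (2 * k, 2 * l) = F k l $$ (0, 0)"
    "block_mat F $$ (2 * k, 2 * l + 1) = F k l $$ (0, 1)"
    "block_mat F $$ (2 * k + 1, 2 * l) = F k l $$ (1, 0)"
    "block_mat F $$ (2 * k + 1, 2 * l + 1) = F k l $$ (1, 1)" if "k < 6" "l < 6" for k l
    using that by (simp_all add: block_mat_def)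
  have "2 * i + a < 12" "2 * j + b < 12" using assms by auto
  then show ?thesis
    unfolding conjugate_entry[OF B \<open>2 * i + a < 12\<close> \<open>2 * j + b < 12\<close>]
      R12_column_sum[OF assms(1,3)] R12_column_sum[OF assms(2,4)] i'_def[symmetric] j'_def[symmetric]
    unfolding entry[OF assms(1,2)] entry[OF assms(1) lt(2)] entry[OF lt(1) assms(2)] entry[OF lt(1,2)]
    by (simp add: block_stat_defs field_simps)
qed

section \<open>The switching matrices\<close>

definition switching_block :: "nat \<Rightarrow> nat \<Rightarrow> nat \<Rightarrow> real mat" where
  "switching_block k i j = (if i < j then upper_block k i j
     else if j < i then transpose_mat (upper_block k j i) else O2)"

lemma transpose_basic_blocks:
  "transpose_mat O2 = O2" "transpose_mat I2 = I2" "transpose_mat N2 = n2" "transpose_mat n2 = N2"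
  by (auto simp: O2_def I2_def n2_def)

lemma block_stats:
  "block_sum O2 = 0" "block_sum I2 = 2" "block_sum N2 = 2" "block_sum n2 = 2"
  "col_diff O2 = 0" "col_diff I2 = 0" "col_diff N2 = 0" "col_diff n2 = - 2"
  "row_diff O2 = 0" "row_diff I2 = 0" "row_diff N2 = - 2" "row_diff n2 = 0"
  "diag_diff O2 = 0" "diag_diff I2 = 2" "diag_diff N2 = 0" "diag_diff n2 = 0"
  by (auto simp: block_stat_defs block_defs)

lemma all_less_6: "(\<forall>i<6. P i) \<longleftrightarrow> P 0 \<and> P 1 \<and> P 2 \<and> P 3 \<and> P 4 \<and> P (5::nat)"
  unfolding less_6_cases by blast

text \<open>
  Complementing a block does not change the four absolute values in the next definition, and
  \<open>conjugate_block_mat_entry\<close> shows that they decide whether conjugation by \<^const>\<open>R12\<close>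
  yields a 0-1 matrix. Hence only the 18 matrices without complemented blocks have to be checked.
\<close>

definition switchable :: "(nat \<Rightarrow> nat \<Rightarrow> real mat) \<Rightarrow> bool" where
  "switchable F \<longleftrightarrow> (\<forall>i<6. \<forall>j<6.
     \<bar>block_sum (F i j) - 2\<bar> + \<bar>col_diff (F i ((j + 1) mod 6))\<bar>
       + \<bar>row_diff (F ((i + 1) mod 6) j)\<bar> + \<bar>diag_diff (F ((i + 1) mod 6) ((j + 1) mod 6))\<bar> = 2)"

text \<open>A finite check. Quantifying over a member \<open>Bs\<close> of the list lets
  \<open>disjE\<close> produce 18 concrete tables, for which the coefficients and transposes of the
  four basic blocks suffice.\<close>

lemma switching_blocks_basic_switchable:
  fixes Bs :: "real mat list list"
  defines "F \<equiv> (\<lambda>i j. if i < j then Bs ! i ! (j - i - 1)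
     else if j < i then transpose_mat (Bs ! j ! (i - j - 1)) else O2)"
  assumes "Bs \<in> set switching_blocks"
  shows "(\<forall>i<6. \<forall>j<6. F i j \<in> {O2, I2, N2, n2}) \<and> switchable F"
  using assms(2)
  unfolding switchable_def all_less_6 F_def switching_blocks_def list.set insert_iff empty_iff
  by (elim disjE; simp add: block_stats transpose_basic_blocks)

lemma switching_block_basic_switchable:
  assumes "k < 18"
  shows switching_block_basic: "i < 6 \<Longrightarrow> j < 6 \<Longrightarrow> switching_block k i j \<in> {O2, I2, N2, n2}"
    and switchable_switching_block: "switchable (switching_block k)"
proof -
  have "switching_blocks ! k \<in> set switching_blocks"
    using assms by (intro nth_mem) (simp add: switching_blocks_def)
  \<comment> \<open>With \<open>Bs\<close> taken as \<open>switching_blocks ! k\<close>, folding the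
    two definitions turns the local \<open>F\<close> into \<open>switching_block k\<close>.\<close>
  from switching_blocks_basic_switchable[OF this, folded upper_block_def, folded switching_block_def]
  show "i < 6 \<Longrightarrow> j < 6 \<Longrightarrow> switching_block k i j \<in> {O2, I2, N2, n2}"
    "switchable (switching_block k)"
    by blast+
qed

text \<open>Exactly the values taken by the basic blocks and their complements. They are all even,
  so absolute values that add up to 2 leave room for only one nonzero term.\<close>

definition even_stats :: "real mat \<Rightarrow> bool" where
  "even_stats M \<longleftrightarrow> block_sum M \<in> {0, 2, 4} \<and> col_diff M \<in> {- 2, 0, 2} \<and>
     row_diff M \<in> {- 2, 0, 2} \<and> diag_diff M \<in> {- 2, 0, 2}"

lemma basic_blocks_carrier: "M \<in> {O2, I2, N2, n2} \<Longrightarrow> M \<in> carrier_mat 2 2"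
  by (auto simp: O2_def I2_def n2_def N2_def mat_of_rows_list_def)

lemma even_stats_basic: "M \<in> {O2, I2, N2, n2} \<Longrightarrow> even_stats M"
  by (auto simp: even_stats_def block_stats)

text \<open>\<open>J2\<close> has block sum 4 and its other coefficients vanish, so by linearity
  three signs flip and the block sum is reflected about 2.\<close>

lemma complement_block_stats:
  assumes "M \<in> carrier_mat 2 2"
  shows "block_sum (J2 - M) = 4 - block_sum M" "col_diff (J2 - M) = - col_diff M"
    "row_diff (J2 - M) = - row_diff M" "diag_diff (J2 - M) = - diag_diff M"
  using assms by (auto simp: block_stat_defs J2_def ones_mat_def)

lemma transpose_complement_block:
  assumes "M \<in> carrier_mat 2 2"
  shows "transpose_mat (J2 - M) = J2 - transpose_mat M"
  using assms by (intro eq_matI) (auto simp: J2_def ones_mat_def)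

lemma switching_matricesE:
  assumes "B \<in> switching_matrices"
  obtains F where "B = block_mat F" "switchable F" "\<And>i j. i < 6 \<Longrightarrow> j < 6 \<Longrightarrow> even_stats (F i j)"
    "\<And>i. F i i = O2"
proof -
  obtain k S where k: "k < 18" and B: "B = sym_block_mat
      (\<lambda>i j. if (i, j) \<in> S then J2 - upper_block k i j else upper_block k i j)"
    using assms by (auto simp: switching_matrices_def)
  let ?G = "switching_block k"
  \<comment> \<open>Complementation is carried over to both triangles, since it commutes with
    transposition. The guards \<open>i < j\<close> and \<open>j < i\<close> discard pairs of
    \<open>S\<close> on or below the diagonal.\<close>
  define F where "F i j = (if i < j \<and> (i, j) \<in> S \<or> j < i \<and> (j, i) \<in> S then J2 - ?G i j else ?G i j)"
    for i j
  have carrier: "?G i j \<in> carrier_mat 2 2" if "i < 6" "j < 6" for i j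
    using switching_block_basic[OF k that] by (rule basic_blocks_carrier)
  have "B = block_mat F"
    unfolding B sym_block_mat_def block_mat_def
  proof (intro cong_mat refl, clarify)
    fix r c :: nat assume "r < 12" "c < 12"
    then have lt: "r div 2 < 6" "c div 2 < 6" by auto
    have "transpose_mat (J2 - upper_block k (c div 2) (r div 2)) =
        J2 - transpose_mat (upper_block k (c div 2) (r div 2))" if "c div 2 < r div 2"
      using carrier[OF lt(2,1)] that by (intro transpose_complement_block) (simp add: switching_block_def)
    then show "(if r div 2 < c div 2 then
          if (r div 2, c div 2) \<in> S then J2 - upper_block k (r div 2) (c div 2) else upper_block k (r div 2) (c div 2)
        else if c div 2 < r div 2 then
          transpose_mat (if (c div 2, r div 2) \<in> S then J2 - upper_block k (c div 2) (r div 2)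
            else upper_block k (c div 2) (r div 2))
        else O2) $$ (r mod 2, c mod 2) = F (r div 2) (c div 2) $$ (r mod 2, c mod 2)"
      by (simp add: F_def switching_block_def)
  qed
  moreover have stats: "\<bar>block_sum (F i j) - 2\<bar> = \<bar>block_sum (?G i j) - 2\<bar>"
    "\<bar>col_diff (F i j)\<bar> = \<bar>col_diff (?G i j)\<bar>" "\<bar>row_diff (F i j)\<bar> = \<bar>row_diff (?G i j)\<bar>"
    "\<bar>diag_diff (F i j)\<bar> = \<bar>diag_diff (?G i j)\<bar>" if "i < 6" "j < 6" for i j
    using abs_minus_commute[of 2 "block_sum (?G i j)"]
    by (simp_all add: F_def complement_block_stats[OF carrier[OF that]])
  have "switchable F"
    using switchable_switching_block[OF k] by (simp add: switchable_def stats)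
  moreover have "even_stats (F i j)" if "i < 6" "j < 6" for i j
    using even_stats_basic[OF switching_block_basic[OF k that]]
    by (auto simp: F_def even_stats_def complement_block_stats[OF carrier[OF that]])
  moreover have "F i i = O2" for i
    by (simp add: F_def switching_block_def)
  ultimately show ?thesis using that by blast
qed

text \<open>Exactly one of \<open>block_sum - 2\<close>, \<open>col_diff\<close>,
  \<open>row_diff\<close>, \<open>diag_diff\<close> at the four blocks is nonzero, and it is 2 or
  -2. Hence four times the entry is 2 plus or minus 2, whatever the signs
  \<open>sgn2\<close>.\<close>

lemma conjugate_switching_matrix_entry:
  assumes "B \<in> switching_matrices" "r < 12" "c < 12"
  shows "(transpose_mat R12 * B * R12) $$ (r, c) \<in> {0, 1}"
proof -
  obtain F where B: "B = block_mat F" and F: "switchable F"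
    "\<And>i j. i < 6 \<Longrightarrow> j < 6 \<Longrightarrow> even_stats (F i j)"
    using assms(1) by (rule switching_matricesE) blast
  define i a j b i' j' where ij: "i = r div 2" "a = r mod 2" "j = c div 2" "b = c mod 2"
    "i' = (i + 1) mod 6" "j' = (j + 1) mod 6"
  have rc: "r = 2 * i + a" "c = 2 * j + b" and lt: "i < 6" "a < 2" "j < 6" "b < 2" "i' < 6" "j' < 6"
    using assms by (auto simp: ij)
  have "\<bar>block_sum (F i j) - 2\<bar> + \<bar>col_diff (F i j')\<bar> + \<bar>row_diff (F i' j)\<bar> + \<bar>diag_diff (F i' j')\<bar> = 2"
    using F(1) lt by (simp add: switchable_def ij)
  moreover have "block_sum (F i j) \<in> {0, 2, 4}" "col_diff (F i j') \<in> {- 2, 0, 2}"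
    "row_diff (F i' j) \<in> {- 2, 0, 2}" "diag_diff (F i' j') \<in> {- 2, 0, 2}"
    using F(2) lt unfolding even_stats_def by blast+
  moreover have "4 * (transpose_mat R12 * B * R12) $$ (r, c) = block_sum (F i j) + sgn2 b * col_diff (F i j')
      + sgn2 a * row_diff (F i' j) + sgn2 a * sgn2 b * diag_diff (F i' j')"
    unfolding B rc conjugate_block_mat_entry[OF lt(1,3,2,4)] ij(5,6) ..
  moreover have "sgn2 a \<in> {1, - 1}" "sgn2 b \<in> {1, - 1}" by (auto simp: sgn2_def)
  ultimately show ?thesis by auto
qed

text \<open>For \<open>i = j\<close> the block \<open>F i i\<close> is \<open>O2\<close>, so the
  term \<open>\<bar>block_sum (F i i) - 2\<bar>\<close> already uses up the total 2 and the other
  coefficients vanish.\<close>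

lemma conjugate_switching_matrix_diag:
  assumes "B \<in> switching_matrices" "r < 12"
  shows "(transpose_mat R12 * B * R12) $$ (r, r) = 0"
proof -
  obtain F where B: "B = block_mat F" and F: "switchable F" "\<And>i. F i i = O2"
    using assms(1) by (rule switching_matricesE) blast
  define i a i' where i: "i = r div 2" "a = r mod 2" "i' = (i + 1) mod 6"
  have r: "r = 2 * i + a" and lt: "i < 6" "a < 2"
    using assms by (auto simp: i)
  have "\<bar>block_sum (F i i) - 2\<bar> + \<bar>col_diff (F i i')\<bar> + \<bar>row_diff (F i' i)\<bar> + \<bar>diag_diff (F i' i')\<bar> = 2"
    using F(1) lt by (simp add: switchable_def i)
  moreover have "4 * (transpose_mat R12 * B * R12) $$ (r, r) = block_sum (F i i) + sgn2 a * col_diff (F i i')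
      + sgn2 a * row_diff (F i' i) + sgn2 a * sgn2 a * diag_diff (F i' i')"
    unfolding B r conjugate_block_mat_entry[OF lt(1,1,2,2)] i(3) ..
  ultimately show ?thesis by (simp add: F(2) block_stats add_nonneg_eq_0_iff)
qed

section \<open>The switched graph\<close>

locale switching_partition =
  fixes G :: "'a pair_pre_digraph" and C :: "nat \<Rightarrow> 'a set" and D :: "'a set"
    and v :: "nat \<Rightarrow> nat \<Rightarrow> 'a" and p :: "'a \<Rightarrow> 'a"
  assumes graph: "pair_graph G"
    and verts: "(\<Union>i<6. C i) \<union> D = pverts G"
    and disjoint_C: "disjoint_family_on C {..<6}"
    and disjoint_D: "(\<Union>i<6. C i) \<inter> D = {}"
    and C_eq: "\<forall>i<6. card (C i) = 2 \<and> C i = {v i 0, v i 1}"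
    and parity: "\<forall>x\<in>D. \<forall>i<6. \<forall>j<6.
      [card (neighbours_in G x (C i)) = card (neighbours_in G x (C j))] (mod 2)"
    and switching: "adjacency_mat G (vertex_list v) \<in> switching_matrices"
    and perm: "\<forall>i<6. \<forall>a<2. p (v i a) = v ((i + 5) mod 6) a"
begin

section \<open>Enumeration of the switched vertices and the cyclic shift\<close>

definition "U = (\<Union>i<6. C i)"
definition "X = switch_vertices G C D"
definition "e = (!) (vertex_list v)"
definition "H = switched_graph G C D v p"

lemma length_vertex_list: "length (vertex_list v) = 12"
  by (simp add: vertex_list_def eval_nat_numeral)

lemma e_block:
  assumes "i < 6" "a < 2"
  shows "e (2 * i + a) = v i a"
  using assms unfolding less_6_cases less_2_cases_iff
  by (elim disjE) (simp_all add: e_def vertex_list_def eval_nat_numeral)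

lemma set_vertex_list: "set (vertex_list v) = U"
  using C_eq by (auto simp: U_def vertex_list_def)

text \<open>By counting: six disjoint sets of size 2 have 12 elements, as many as the list has
  entries.\<close>

lemma distinct_vertex_list: "distinct (vertex_list v)"
proof -
  have "card U = (\<Sum>i<6. card (C i))"
    unfolding U_def using disjoint_C C_eq
    by (intro card_UN_disjoint') (auto simp: disjoint_family_on_def)
  also have "\<dots> = (\<Sum>i<6::nat. 2)" using C_eq by (intro sum.cong) auto
  also have "\<dots> = 12" by simp
  finally show ?thesis
    by (intro card_distinct) (simp add: set_vertex_list length_vertex_list)
qed

lemma e_inj: "r < 12 \<Longrightarrow> c < 12 \<Longrightarrow> e r = e c \<longleftrightarrow> r = c"
  by (simp add: e_def nth_eq_iff_index_eq distinct_vertex_list length_vertex_list)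

lemma bij_betw_e: "bij_betw e {..<12} U"
  unfolding e_def
  by (intro bij_betw_nth) (simp_all add: distinct_vertex_list length_vertex_list set_vertex_list)

lemma e_in_U: "r < 12 \<Longrightarrow> e r \<in> U"
  using bij_betw_e by (auto simp: bij_betw_def)

lemma U_cases:
  assumes "x \<in> U"
  obtains r where "r < 12" "x = e r"
  using assms bij_betw_e by (auto simp: bij_betw_def)

lemma v_inj:
  assumes "i < 6" "j < 6" "a < 2" "b < 2"
  shows "v i a = v j b \<longleftrightarrow> i = j \<and> a = b"
proof -
  have "v i a = v j b \<longleftrightarrow> 2 * i + a = 2 * j + b"
    using e_inj[of "2 * i + a" "2 * j + b"] assms by (simp add: e_block)
  also have "\<dots> \<longleftrightarrow> i = j \<and> a = b" using assms by presburger
  finally show ?thesis .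
qed

lemma v_in_U: "i < 6 \<Longrightarrow> a < 2 \<Longrightarrow> v i a \<in> U"
  using e_in_U[of "2 * i + a"] by (simp add: e_block)

lemma U_cases_v:
  assumes "x \<in> U"
  obtains i a where "i < 6" "a < 2" "x = v i a"
proof -
  obtain r where r: "r < 12" "x = e r" using assms by (rule U_cases)
  then have "x = v (r div 2) (r mod 2)" using e_block[of "r div 2" "r mod 2"] by simp
  then show ?thesis using r(1) by (intro that[of "r div 2" "r mod 2"]) auto
qed

lemma p_in_U: "x \<in> U \<Longrightarrow> p x \<in> U"
  by (elim U_cases_v) (simp add: perm v_in_U)

text \<open>Adding 5 and adding 1 are inverse modulo 6. The preimage thus lies in the next pair, the
  one that \<open>Y2\<close> sees in column block \<open>i\<close>.\<close>

lemma p_eq_iff: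
  assumes "w \<in> U" "i < 6" "a < 2"
  shows "p w = v i a \<longleftrightarrow> w = v ((i + 1) mod 6) a"
proof -
  obtain j b where jb: "j < 6" "b < 2" "w = v j b" using assms(1) by (rule U_cases_v)
  have "(j + 5) mod 6 = i \<longleftrightarrow> j = (i + 1) mod 6"
    using jb(1) assms(2) unfolding less_6_cases by (elim disjE) simp_all
  then show ?thesis using jb assms by (simp add: perm v_inj)
qed

lemma D_not_U: "x \<in> D \<Longrightarrow> x \<notin> U"
  using disjoint_D by (auto simp: U_def)

lemma verts_eq: "pverts G = U \<union> D"
  using verts by (simp add: U_def)

lemma finite_U_D: "finite (U \<union> D)"
  using graph verts_eq pair_fin_digraph.pair_finite_verts pair_graph_def pair_digraph_def by metis

lemma parcs_sym: "(x, y) \<in> parcs G \<Longrightarrow> (y, x) \<in> parcs G"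
proof -
  interpret pair_graph G by (rule graph)
  show "(x, y) \<in> parcs G \<Longrightarrow> (y, x) \<in> parcs G" using pair_sym_arcs by (auto simp: symmetric_def sym_def)
qed

lemma X_subset_D: "X \<subseteq> D"
  by (auto simp: X_def switch_vertices_def)

section \<open>Arcs of the switched graph\<close>

lemma pverts_H: "pverts H = U \<union> D"
  by (simp add: H_def switched_graph_def Let_def verts_eq)

lemma parcs_H: "parcs H = (parcs G - (X \<times> U \<union> U \<times> X \<union> U \<times> U))
    \<union> {(x, p w) | x w. x \<in> X \<and> w \<in> U \<and> (x, w) \<in> parcs G}
    \<union> {(p w, x) | x w. x \<in> X \<and> w \<in> U \<and> (w, x) \<in> parcs G}
    \<union> {(e r, e c) | r c. r < 12 \<and> c < 12 \<and> switched_mat G v $$ (r, c) = 1}"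
  by (simp add: H_def switched_graph_def Let_def U_def X_def e_def)

lemma H_D_D:
  assumes "x \<in> D" "y \<in> D"
  shows "(x, y) \<in> parcs H \<longleftrightarrow> (x, y) \<in> parcs G"
  using D_not_U[OF assms(1)] D_not_U[OF assms(2)] by (auto simp: parcs_H p_in_U e_in_U)

text \<open>All old arcs inside \<open>U\<close> are deleted and every shifted arc has an end in
  \<open>X\<close>, which is disjoint from \<open>U\<close>; only the arcs read off the matrix
  remain.\<close>

lemma H_U_U:
  assumes "r < 12" "c < 12"
  shows "(e r, e c) \<in> parcs H \<longleftrightarrow> switched_mat G v $$ (r, c) = 1"
proof -
  have "e r \<notin> X" "e c \<notin> X" using assms e_in_U X_subset_D D_not_U by blast+
  then show ?thesis using assms by (auto simp: parcs_H e_in_U e_inj)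
qed

lemma H_D_U:
  assumes "x \<in> D" "i < 6" "a < 2"
  shows "(x, v i a) \<in> parcs H \<longleftrightarrow>
    (if x \<in> X then (x, v ((i + 1) mod 6) a) \<in> parcs G else (x, v i a) \<in> parcs G)"
proof -
  have "(x, v i a) \<in> parcs H \<longleftrightarrow> (x \<notin> X \<and> (x, v i a) \<in> parcs G) \<or>
      (x \<in> X \<and> (\<exists>w\<in>U. p w = v i a \<and> (x, w) \<in> parcs G))"
    using D_not_U[OF assms(1)] v_in_U[OF assms(2,3)] by (auto simp: parcs_H p_in_U e_in_U)
  also have "(\<exists>w\<in>U. p w = v i a \<and> (x, w) \<in> parcs G) \<longleftrightarrow> (x, v ((i + 1) mod 6) a) \<in> parcs G"
    using p_eq_iff[OF _ assms(2,3)] v_in_U[of "(i + 1) mod 6" a] assms(3) by auto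
  finally show ?thesis by simp
qed

section \<open>Adjacency before and after switching\<close>

definition adj :: "'a pair_pre_digraph \<Rightarrow> 'a \<Rightarrow> 'a \<Rightarrow> real" where
  "adj K x y = (if (x, y) \<in> parcs K then 1 else 0)"

lemma adjacency_mat_eq: "adjacency_mat K vs = kernel_mat (adj K) vs vs"
  by (simp add: adjacency_mat_def kernel_mat_def adj_def)

lemma adj_sym: "adj G x y = adj G y x"
  using parcs_sym by (auto simp: adj_def)

lemma adjacency_mat_carrier: "adjacency_mat G (vertex_list v) \<in> carrier_mat 12 12"
  by (simp add: adjacency_mat_def length_vertex_list)

lemma switched_mat_entry:
  assumes "r < 12" "c < 12"
  shows "switched_mat G v $$ (r, c) = (\<Sum>s<12. R12 $$ (s, r) * (\<Sum>t<12. R12 $$ (t, c) * adj G (e s) (e t)))"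
  unfolding switched_mat_def conjugate_entry[OF adjacency_mat_carrier assms]
  by (intro sum.cong refl arg_cong[where f = "\<lambda>x. _ * x"])
    (simp add: adjacency_mat_def adj_def e_def length_vertex_list)

lemma switched_mat_sym:
  assumes "r < 12" "c < 12"
  shows "switched_mat G v $$ (r, c) = switched_mat G v $$ (c, r)"
proof -
  have "switched_mat G v $$ (r, c) = (\<Sum>t<12. \<Sum>s<12. R12 $$ (s, r) * (R12 $$ (t, c) * adj G (e s) (e t)))"
    unfolding switched_mat_entry[OF assms] sum_distrib_left by (rule sum.swap)
  also have "\<dots> = switched_mat G v $$ (c, r)"
    unfolding switched_mat_entry[OF assms(2,1)] sum_distrib_left
    by (intro sum.cong refl) (simp add: adj_sym mult.left_commute)
  finally show ?thesis .
qed

text \<open>The arcs of \<open>H\<close> inside \<open>U\<close> record only where the entry is 1.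
  They determine the matrix because its entries are 0 or 1.\<close>

lemma switched_mat_eq_adj:
  assumes "r < 12" "c < 12"
  shows "switched_mat G v $$ (r, c) = adj H (e r) (e c)"
  using conjugate_switching_matrix_entry[OF switching assms] H_U_U[OF assms]
  by (auto simp: adj_def switched_mat_def)

text \<open>The deleted region is symmetric, the two sets of shifted arcs are reverses of each
  other, and the conjugated matrix is symmetric.\<close>

lemma H_sym:
  assumes "(x, y) \<in> parcs H"
  shows "(y, x) \<in> parcs H"
proof -
  consider "(x, y) \<in> parcs G - (X \<times> U \<union> U \<times> X \<union> U \<times> U)"
    | w where "x \<in> X" "w \<in> U" "(x, w) \<in> parcs G" "y = p w"
    | w where "y \<in> X" "w \<in> U" "(w, y) \<in> parcs G" "x = p w"
    | r c where "r < 12" "c < 12" "switched_mat G v $$ (r, c) = 1" "x = e r" "y = e c"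
    using assms unfolding parcs_H by blast
  then show ?thesis
  proof cases
    case 4
    then show ?thesis using H_U_U switched_mat_sym by metis
  qed (use parcs_sym in \<open>auto simp: parcs_H\<close>)
qed

lemma card_neighbours_in_C:
  assumes "i < 6"
  shows "real (card (neighbours_in G x (C i))) = adj G x (v i 0) + adj G x (v i 1)"
proof -
  have "v i 0 \<noteq> v i 1" using v_inj[of i i 0 1] assms by simp
  moreover have "neighbours_in G x (C i) =
      (if (x, v i 0) \<in> parcs G then {v i 0} else {}) \<union> (if (x, v i 1) \<in> parcs G then {v i 1} else {})"
    using C_eq assms by (auto simp: neighbours_in_def)
  ultimately show ?thesis by (simp add: adj_def)
qed

text \<open>If \<open>x\<close> saw just one vertex of \<open>C i\<close>, parity would make all six
  neighbour counts odd; being at most 2 they would all be 1, which puts \<open>x\<close> into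
  \<open>X\<close>.\<close>

lemma not_X_twins:
  assumes "x \<in> D" "x \<notin> X" "i < 6"
  shows "adj G x (v i 0) = adj G x (v i 1)"
proof (rule ccontr)
  assume "adj G x (v i 0) \<noteq> adj G x (v i 1)"
  then have "real (card (neighbours_in G x (C i))) = 1"
    unfolding card_neighbours_in_C[OF assms(3)] by (auto simp: adj_def split: if_splits)
  then have "card (neighbours_in G x (C i)) = 1" by simp
  have "card (neighbours_in G x (C j)) = 1" if "j < 6" for j
  proof -
    have "card (neighbours_in G x (C j)) mod 2 = 1"
      using parity assms(1,3) that \<open>card (neighbours_in G x (C i)) = 1\<close> by (metis cong_def mod_less one_less_numeral_iff
        semiring_norm(76))
    moreover have "real (card (neighbours_in G x (C j))) \<le> 2"
      unfolding card_neighbours_in_C[OF that] by (auto simp: adj_def)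
    then have "card (neighbours_in G x (C j)) \<le> 2" by simp
    ultimately show ?thesis by presburger
  qed
  then have "x \<in> X" using assms(1) by (simp add: X_def switch_vertices_def)
  with assms(2) show False by simp
qed

lemma X_neighbours:
  assumes "x \<in> X" "i < 6"
  shows "adj G x (v i 0) + adj G x (v i 1) = 1"
  using assms card_neighbours_in_C[of i x] by (simp add: X_def switch_vertices_def)

text \<open>For \<open>x\<close> in \<open>X\<close> the average over pair \<open>i\<close> is 1/2
  and the difference over pair \<open>i'\<close> is 1 or -1, which together give the adjacency to
  \<open>v i' a\<close>. Otherwise the difference is 0 and the average is the common value on pair
  \<open>i\<close>.\<close>

lemma R12_column_adj:
  assumes "x \<in> D" "c < 12"
  shows "(\<Sum>t<12. R12 $$ (t, c) * adj G x (e t)) = adj H x (e c)"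
proof -
  define i a i' where i: "i = c div 2" "a = c mod 2" "i' = (i + 1) mod 6"
  have c: "c = 2 * i + a" and lt: "i < 6" "i' < 6" "a < 2"
    using assms by (auto simp: i)
  have "(\<Sum>t<12. R12 $$ (t, c) * adj G x (e t)) = (adj G x (v i 0) + adj G x (v i 1)) / 2
      + sgn2 a * (adj G x (v i' 0) - adj G x (v i' 1)) / 2"
    using e_block[OF lt(1), of 0] e_block[OF lt(1), of 1] e_block[OF lt(2), of 0] e_block[OF lt(2), of 1]
    unfolding c R12_column_sum[OF lt(1,3)] i(3)[symmetric] by simp
  also have "\<dots> = (if x \<in> X then adj G x (v i' a) else adj G x (v i a))"
  proof (cases "x \<in> X")
    case True
    from X_neighbours[OF this lt(1)] X_neighbours[OF this lt(2)] show ?thesis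
      using lt(3) True by (auto simp: less_2_cases_iff sgn2_def field_simps)
  next
    case False
    from not_X_twins[OF assms(1) this lt(1)] not_X_twins[OF assms(1) this lt(2)] show ?thesis
      using lt(3) False by (auto simp: less_2_cases_iff)
  qed
  also have "\<dots> = adj H x (v i a)"
    by (simp add: adj_def H_D_U[OF assms(1) lt(1,3)] i(3))
  finally show ?thesis by (simp add: c e_block lt)
qed

section \<open>The orthogonal matrix on all vertices\<close>

definition Q :: "'a \<Rightarrow> 'a \<Rightarrow> real" where
  "Q x y = (if x \<in> U \<and> y \<in> U
     then R12 $$ (the_inv_into {..<12} e x, the_inv_into {..<12} e y)
     else if x = y then 1 else 0)"

lemma Q_e: "r < 12 \<Longrightarrow> c < 12 \<Longrightarrow> Q (e r) (e c) = R12 $$ (r, c)"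
  using bij_betw_e by (simp add: Q_def e_in_U the_inv_into_f_f bij_betw_def)

text \<open>The column of \<open>Q\<close> at a vertex of \<open>D\<close> is a unit vector; the
  companion \<open>sum_Q_U\<close> treats columns supported on \<open>U\<close>. All sums against
  columns of \<open>Q\<close> reduce to these two cases.\<close>

lemma sum_Q_D:
  assumes "x \<in> D"
  shows "(\<Sum>y\<in>U \<union> D. Q y x * h y) = h x"
proof -
  have "(\<Sum>y\<in>U \<union> D. Q y x * h y) = (\<Sum>y\<in>U \<union> D. if y = x then h y else 0)"
    using D_not_U[OF assms] by (intro sum.cong) (auto simp: Q_def)
  then show ?thesis using finite_U_D assms by simp
qed

lemma sum_Q_U:
  assumes "c < 12"
  shows "(\<Sum>y\<in>U \<union> D. Q y (e c) * h y) = (\<Sum>s<12. R12 $$ (s, c) * h (e s))"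
proof -
  have "(\<Sum>y\<in>U \<union> D. Q y (e c) * h y) = (\<Sum>y\<in>U. Q y (e c) * h y)"
    using finite_U_D e_in_U[OF assms] by (intro sum.mono_neutral_right) (auto simp: Q_def)
  also have "\<dots> = (\<Sum>s<12. Q (e s) (e c) * h (e s))"
    by (rule sum.reindex_bij_betw[OF bij_betw_e, symmetric])
  finally show ?thesis using assms by (simp add: Q_e)
qed

lemma Q_orthogonal:
  assumes "x \<in> U \<union> D" "z \<in> U \<union> D"
  shows "(\<Sum>y\<in>U \<union> D. Q y x * Q y z) = (if x = z then 1 else 0)"
proof (cases "x \<in> D")
  case True
  then show ?thesis using D_not_U[OF True] unfolding sum_Q_D[OF True] by (simp add: Q_def)
next
  case False
  then obtain r where r: "r < 12" "x = e r" using assms(1) by (auto elim: U_cases)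
  show ?thesis
  proof (cases "z \<in> D")
    case True
    then have "z \<notin> U" by (rule D_not_U)
    then have "Q (e s) z = 0" if "s < 12" for s
      using e_in_U[OF that] by (auto simp: Q_def)
    moreover have "x \<noteq> z" using r e_in_U \<open>z \<notin> U\<close> by blast
    ultimately show ?thesis using r by (simp add: sum_Q_U)
  next
    case False
    then obtain c where "c < 12" "z = e c" using assms(2) by (auto elim: U_cases)
    then show ?thesis using r by (simp add: sum_Q_U Q_e R12_orthogonal e_inj)
  qed
qed

lemma sum_Q_one:
  assumes "x \<in> U \<union> D"
  shows "(\<Sum>y\<in>U \<union> D. Q y x) = 1"
proof (cases "x \<in> D")
  case True
  then show ?thesis using sum_Q_D[of x "\<lambda>_. 1"] by simp
next
  case False
  then obtain c where "c < 12" "x = e c" using assms by (auto elim: U_cases)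
  then show ?thesis using sum_Q_U[of c "\<lambda>_. 1"] by (simp add: sum_R12_column)
qed

lemma adj_H_eq:
  assumes "x \<in> U \<union> D" "z \<in> U \<union> D"
  shows "adj H x z = (\<Sum>y\<in>U \<union> D. Q y x * (\<Sum>w\<in>U \<union> D. Q w z * adj G y w))"
proof (cases "z \<in> D")
  case z: True
  show ?thesis
  proof (cases "x \<in> D")
    case True
    then show ?thesis using z by (simp add: sum_Q_D adj_def H_D_D)
  next
    case False
    then obtain r where r: "r < 12" "x = e r" using assms(1) by (auto elim: U_cases)
    \<comment> \<open>\<open>R12_column_adj\<close> expects the vertex of \<open>D\<close> first, so
      this mixed case is reduced to it by the symmetry of \<open>H\<close> and of
      \<open>G\<close>.\<close>
    have "adj H x z = adj H z x" using H_sym by (auto simp: adj_def)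
    then show ?thesis
      using r z by (simp add: sum_Q_D sum_Q_U R12_column_adj[symmetric] adj_sym[of z])
  qed
next
  case False
  then obtain c where c: "c < 12" "z = e c" using assms(2) by (auto elim: U_cases)
  show ?thesis
  proof (cases "x \<in> D")
    case True
    then show ?thesis using c by (simp add: sum_Q_D sum_Q_U R12_column_adj)
  next
    case False
    then obtain r where "r < 12" "x = e r" using assms(1) by (auto elim: U_cases)
    then show ?thesis using c by (simp add: sum_Q_U switched_mat_eq_adj[symmetric] switched_mat_entry)
  qed
qed

text \<open>Columns of \<open>Q\<close> sum to 1, so the constant \<open>s\<close> passes through
  both sums. The factors are ordered as \<open>spectrum_mset_kernel_mat_eq\<close> expects
  them.\<close>

lemma adj_H_shift_eq:
  assumes "x \<in> U \<union> D" "z \<in> U \<union> D"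
  shows "adj H x z + s = (\<Sum>y\<in>U \<union> D. Q y x * (\<Sum>w\<in>U \<union> D. (adj G y w + s) * Q w z))"
proof -
  have "(\<Sum>w\<in>U \<union> D. (adj G y w + s) * Q w z) = (\<Sum>w\<in>U \<union> D. Q w z * adj G y w) + s" for y
  proof -
    have "(\<Sum>w\<in>U \<union> D. (adj G y w + s) * Q w z) = (\<Sum>w\<in>U \<union> D. Q w z * adj G y w + s * Q w z)"
      by (intro sum.cong) (simp_all add: algebra_simps)
    also have "\<dots> = (\<Sum>w\<in>U \<union> D. Q w z * adj G y w) + s * (\<Sum>w\<in>U \<union> D. Q w z)"
      by (simp only: sum.distrib sum_distrib_left)
    finally show ?thesis using sum_Q_one[OF assms(2)] by simp
  qed
  then show ?thesis
    using sum_Q_one[OF assms(1)]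
    by (simp add: adj_H_eq[OF assms] distrib_left sum.distrib flip: sum_distrib_right)
qed

section \<open>Simplicity and cospectrality of the switched graph\<close>

lemma pair_graph_H: "pair_graph H"
proof -
  interpret pair_graph G by (rule graph)
  have arcs: "x \<in> U \<union> D \<and> y \<in> U \<union> D \<and> x \<noteq> y" if "(x, y) \<in> parcs H" for x y
  proof -
    \<comment> \<open>Shifted arcs join \<open>U\<close> to \<open>D\<close> and retained arcs come
      from the loopless \<open>G\<close>, so only the diagonal of the conjugate could produce
      loops.\<close>
    have "switched_mat G v $$ (r, r) = 0" if "r < 12" for r
      using conjugate_switching_matrix_diag[OF switching that] by (simp add: switched_mat_def)
    then have "r \<noteq> c" if "switched_mat G v $$ (r, c) = 1" "r < 12" for r c
      using that by (metis zero_neq_one)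
    then have "e r \<noteq> e c" if "switched_mat G v $$ (r, c) = 1" "r < 12" "c < 12" for r c
      using that e_inj by blast
    moreover have "p w \<in> U" "p w \<noteq> x" "x \<in> D" if "w \<in> U" "x \<in> X" for w x
      using that p_in_U X_subset_D D_not_U by blast+
    moreover have "x \<in> U \<union> D" "y \<in> U \<union> D" "x \<noteq> y" if "(x, y) \<in> parcs G" for x y
      using arc_fst_in_verts[OF that] arc_snd_in_verts[OF that] pair_no_loops[OF that]
      by (auto simp: verts_eq)
    ultimately show ?thesis using that e_in_U unfolding parcs_H by blast
  qed
  then have "parcs H \<subseteq> (U \<union> D) \<times> (U \<union> D)" by auto
  then have "finite (parcs H)" by (rule finite_subset) (intro finite_cartesian_product finite_U_D)
  moreover have "symmetric (with_proj H)"
    using H_sym by (auto simp: symmetric_def sym_def)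
  ultimately show ?thesis
    using finite_U_D by unfold_locales (auto simp: pverts_H dest: arcs)
qed

lemma adjacency_mat_H: "adjacency_mat H (vertex_list v) = switched_mat G v"
proof (rule eq_matI)
  fix r c
  assume "r < dim_row (switched_mat G v)" "c < dim_col (switched_mat G v)"
  then have "r < 12" "c < 12" using R12_carrier by (auto simp: switched_mat_def)
  then show "adjacency_mat H (vertex_list v) $$ (r, c) = switched_mat G v $$ (r, c)"
    by (simp add: switched_mat_eq_adj adjacency_mat_def adj_def e_def length_vertex_list)
qed (use R12_carrier in \<open>auto simp: switched_mat_def adjacency_mat_def length_vertex_list\<close>)

lemma R_cospectral_H: "R_cospectral G H"
  unfolding R_cospectral_def verts_eq pverts_H
proof (intro allI impI, elim conjE)
  fix vs ws s
  assume vs: "distinct vs" "set vs = U \<union> D" and ws: "distinct ws" "set ws = U \<union> D"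
  \<comment> \<open>The shift by \<open>s\<close> times the all-ones matrix is absorbed into the
    kernel, so each \<open>s\<close> is one instance of the conjugation lemma.\<close>
  have "adjacency_mat K us + s \<cdot>\<^sub>m ones_mat (length us) = kernel_mat (\<lambda>x y. adj K x y + s) us us" for K us
    by (intro eq_matI) (auto simp: adjacency_mat_eq kernel_mat_def ones_mat_def)
  then show "spectrum_mset (adjacency_mat G vs + s \<cdot>\<^sub>m ones_mat (length vs)) =
      spectrum_mset (adjacency_mat H ws + s \<cdot>\<^sub>m ones_mat (length ws))"
    using spectrum_mset_kernel_mat_eq[OF vs ws Q_orthogonal adj_H_shift_eq] by simp
qed

end

text \<open>\<open>switched_graph\<close> keeps only positions where the conjugate equals 1, so both
  that the result is a simple graph and that it has the prescribed induced matrix are claims of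
  their own.\<close>

theorem theorem23:
  fixes \<Gamma> :: "'a pair_pre_digraph"
    and C :: "nat \<Rightarrow> 'a set" and D :: "'a set"
    and v :: "nat \<Rightarrow> nat \<Rightarrow> 'a" and \<pi> :: "'a \<Rightarrow> 'a"
  assumes "pair_graph \<Gamma>"
    and "(\<Union>i<6. C i) \<union> D = pverts \<Gamma>"
    and "disjoint_family_on C {..<6}"
    and "(\<Union>i<6. C i) \<inter> D = {}"
    and "\<forall>i<6. card (C i) = 2 \<and> C i = {v i 0, v i 1}"
    and "\<forall>x\<in>D. \<forall>i<6. \<forall>j<6.
           [card (neighbours_in \<Gamma> x (C i)) = card (neighbours_in \<Gamma> x (C j))] (mod 2)"
    and "adjacency_mat \<Gamma> (vertex_list v) \<in> switching_matrices"
    and "\<forall>i<6. \<forall>a<2. \<pi> (v i a) = v ((i + 5) mod 6) a"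
  shows "let \<Gamma>' = switched_graph \<Gamma> C D v \<pi> in
           pair_graph \<Gamma>'
         \<and> adjacency_mat \<Gamma>' (vertex_list v) =
             transpose_mat R12 * adjacency_mat \<Gamma> (vertex_list v) * R12
         \<and> R_cospectral \<Gamma> \<Gamma>'"
proof -
  interpret switching_partition \<Gamma> C D v \<pi>
    using assms by (rule switching_partition.intro)
  show ?thesis
    using pair_graph_H adjacency_mat_H R_cospectral_H
    by (simp add: Let_def H_def switched_mat_def)
qed

end
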